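(* For every positive integer $n$, let $\pi(n)$ denote the number of primes less than or equal to $n$. Then \[ \pi(n)=n-1-\sum_{i=2}^{\lfloor\sqrt{n}\rfloor}\left(\left\lfloor\frac{n}{i}\right\rfloor-i+1\right)+\sum_{s=2}^{\lfloor\sqrt{n}\rfloor}(-1)^{s}\sum_{1<i_1<i_2<\dots<i_s\leqslant\lfloor\sqrt{n}\rfloor}\left(\left\lfloor\frac{n}{\operatorname{LCM}(i_1,\dots,i_s)}\right\rfloor-\left\lfloor\frac{i_s^2-1}{\operatorname{LCM}(i_1,\dots,i_s)}\right\rfloor\right), \] where the inner sum runs over all strictly increasing $s$-tuples of integers $i_1<\dots<i_s$ with $1<i_1$ and $i_s\leqslant\lfloor\sqrt n\rfloor$.
   Context: $\lfloor x\rfloor$ denotes the floor of $x$, and $\operatorname{LCM}(i_1,\dots,i_s)$ denotes the least common multiple of the positive integers $i_1,\dots,i_s$. Empty sums are zero. *)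

theory Defs
  imports Complex_Main "HOL-Computational_Algebra.Primes"
begin

definition prime_pi :: "nat \<Rightarrow> nat" where
  "prime_pi n = card {p. prime p \<and> p \<le> n}"

(* The tuples 1 < i_1 < ... < i_s \<le> m, encoded as lists [i_1, ..., i_s]. *)
definition increasing_tuples :: "nat \<Rightarrow> nat \<Rightarrow> nat list set" where
  "increasing_tuples s m =
     {is. length is = s \<and> sorted_wrt (<) is \<and> (\<forall>i\<in>set is. 1 < i \<and> i \<le> m)}"

end

theory Submission
  imports Defs "HOL-Library.Discrete_Functions"
begin

text \<open>
  Every composite number \<open>x \<le> n\<close> has a divisor \<open>i > 1\<close> with \<open>i\<^sup>2 \<le> x\<close>, so the composites up to \<open>n\<close>
  are the union, over \<open>2 \<le> i \<le> \<lfloor>\<surd>n\<rfloor>\<close>, of the sets of multiples of \<open>i\<close> in \<open>[i\<^sup>2, n]\<close>. An intersection of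
  such sets over an index set \<open>I\<close> consists of the multiples of \<open>Lcm I\<close> in \<open>[(Max I)\<^sup>2, n]\<close>, and the
  formula is inclusion-exclusion with the terms grouped by \<open>card I\<close>.
\<close>

lemma sum_nonempty_subsets_by_card:
  fixes g :: "'a set \<Rightarrow> 'b::comm_monoid_add"
  assumes "finite A" "card A \<le> k"
  shows "(\<Sum>B | B \<subseteq> A \<and> B \<noteq> {}. g B) =
    (\<Sum>a\<in>A. g {a}) + (\<Sum>s = 2..k. \<Sum>B | B \<subseteq> A \<and> card B = s. g B)"
proof -
  have card_range: "card ` {B. B \<subseteq> A \<and> B \<noteq> {}} \<subseteq> insert 1 {2..k}"
  proof (rule image_subsetI)
    fix B assume "B \<in> {B. B \<subseteq> A \<and> B \<noteq> {}}"
    then have "0 < card B" "card B \<le> k"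
      using assms card_mono[of A B] by (auto simp: card_gt_0_iff intro: finite_subset)
    then show "card B \<in> insert 1 {2..k}"
      by auto
  qed
  have nonempty_of_card: "{B. (B \<subseteq> A \<and> B \<noteq> {}) \<and> card B = s} = {B. B \<subseteq> A \<and> card B = s}"
    if "s \<noteq> 0" for s
    using that by auto
  have singletons: "{B. B \<subseteq> A \<and> card B = 1} = (\<lambda>a. {a}) ` A"
    by (auto simp: card_1_singleton_iff)
  have "(\<Sum>B | B \<subseteq> A \<and> B \<noteq> {}. g B) =
      (\<Sum>s\<in>insert 1 {2..k}. \<Sum>B | (B \<subseteq> A \<and> B \<noteq> {}) \<and> card B = s. g B)"
    using assms(1) sum.group[OF _ _ card_range, of g] by simp
  also have "\<dots> = (\<Sum>s\<in>insert 1 {2..k}. \<Sum>B | B \<subseteq> A \<and> card B = s. g B)"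
    by (intro sum.cong refl nonempty_of_card) auto
  also have "\<dots> = (\<Sum>B | B \<subseteq> A \<and> card B = 1. g B) +
      (\<Sum>s = 2..k. \<Sum>B | B \<subseteq> A \<and> card B = s. g B)"
    by (rule sum.insert) auto
  also have "(\<Sum>B | B \<subseteq> A \<and> card B = 1. g B) = (\<Sum>a\<in>A. g {a})"
    unfolding singletons by (simp add: sum.reindex)
  finally show ?thesis .
qed

lemma (in Incl_Excl) restricted_indexed_by_card:
  assumes "finite A" "card A \<le> k" and "\<And>a. a \<in> A \<Longrightarrow> P (X a)"
  shows "f (\<Union>(X ` A)) =
    (\<Sum>a\<in>A. f (X a)) - (\<Sum>s = 2..k. (- 1) ^ s * (\<Sum>B | B \<subseteq> A \<and> card B = s. f (\<Inter>(X ` B))))"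
proof -
  have "f (\<Union>(X ` A)) = (\<Sum>B | B \<subseteq> A \<and> B \<noteq> {}. (- 1) ^ (card B + 1) * f (\<Inter>(X ` B)))"
    using assms by (intro restricted_indexed)
  also have "\<dots> = (\<Sum>a\<in>A. f (X a)) +
      (\<Sum>s = 2..k. \<Sum>B | B \<subseteq> A \<and> card B = s. (- 1) ^ (card B + 1) * f (\<Inter>(X ` B)))"
    using assms by (simp add: sum_nonempty_subsets_by_card)
  also have "\<dots> = (\<Sum>a\<in>A. f (X a)) -
      (\<Sum>s = 2..k. (- 1) ^ s * (\<Sum>B | B \<subseteq> A \<and> card B = s. f (\<Inter>(X ` B))))"
    by (simp add: sum_negf sum_distrib_left)
  finally show ?thesis .
qed

lemma int_card_UN_by_card:
  assumes "finite A" "card A \<le> k" and "\<And>a. a \<in> A \<Longrightarrow> finite (X a)"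
  shows "int (card (\<Union>a\<in>A. X a)) = (\<Sum>a\<in>A. int (card (X a))) -
    (\<Sum>s = 2..k. (- 1) ^ s * (\<Sum>B | B \<subseteq> A \<and> card B = s. int (card (\<Inter>b\<in>B. X b))))"
proof -
  interpret Incl_Excl finite "int \<circ> card"
    by standard (auto simp: card_Un_disjnt)
  show ?thesis
    using restricted_indexed_by_card[OF assms] by simp
qed

lemma sorted_last_eq_Max:
  fixes xs :: "'a::linorder list"
  assumes "sorted xs" "xs \<noteq> []"
  shows "last xs = Max (set xs)"
  using assms by (induction xs) (auto simp: max_def)

lemma bij_betw_set_increasing_tuples:
  "bij_betw set (increasing_tuples s m) {I. I \<subseteq> {2..m} \<and> card I = s}"
proof (rule bij_betw_byWitness[where f' = sorted_list_of_set])
  show "\<forall>xs\<in>increasing_tuples s m. sorted_list_of_set (set xs) = xs"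
    by (auto simp: increasing_tuples_def strict_sorted_iff sorted_list_of_set.idem_if_sorted_distinct)
  show "\<forall>I\<in>{I. I \<subseteq> {2..m} \<and> card I = s}. set (sorted_list_of_set I) = I"
    by (auto simp: finite_subset[of _ "{2..m}"])
  show "set ` increasing_tuples s m \<subseteq> {I. I \<subseteq> {2..m} \<and> card I = s}"
    by (auto simp: increasing_tuples_def strict_sorted_iff distinct_card)
  show "sorted_list_of_set ` {I. I \<subseteq> {2..m} \<and> card I = s} \<subseteq> increasing_tuples s m"
    by (fastforce simp: increasing_tuples_def finite_subset[of _ "{2..m}"])
qed

lemma nat_floor_sqrt_eq_floor_sqrt: "nat \<lfloor>sqrt (real n)\<rfloor> = floor_sqrt n"
proof -
  have "i \<le> nat \<lfloor>sqrt (real n)\<rfloor> \<longleftrightarrow> i \<le> floor_sqrt n" for i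
  proof -
    have "i \<le> nat \<lfloor>sqrt (real n)\<rfloor> \<longleftrightarrow> real i \<le> sqrt (real n)"
      by (simp add: le_nat_iff le_floor_iff)
    also have "\<dots> \<longleftrightarrow> sqrt (real (i\<^sup>2)) \<le> sqrt (real n)"
      by simp
    also have "\<dots> \<longleftrightarrow> i \<le> floor_sqrt n"
      by (simp only: real_sqrt_le_iff of_nat_le_iff le_floor_sqrt_iff)
    finally show ?thesis .
  qed
  then show ?thesis
    by (meson eq_iff)
qed

lemma not_prime_iff_dvd_square_le:
  fixes x :: nat
  assumes "x > 1"
  shows "\<not> prime x \<longleftrightarrow> (\<exists>i\<ge>2. i dvd x \<and> i\<^sup>2 \<le> x)"
proof
  assume "\<not> prime x"
  then obtain a b where "x = a * b" "a \<noteq> 1" "b \<noteq> 1"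
    using assms by (auto simp: prime_nat_iff)
  moreover from this have "a \<noteq> 0" "b \<noteq> 0"
    using assms by (auto intro!: gr0I)
  ultimately have "2 \<le> min a b" "min a b dvd x" "(min a b)\<^sup>2 \<le> x"
    by (auto simp: min_def power2_eq_square)
  then show "\<exists>i\<ge>2. i dvd x \<and> i\<^sup>2 \<le> x"
    by blast
next
  assume "\<exists>i\<ge>2. i dvd x \<and> i\<^sup>2 \<le> x"
  then obtain i where "i \<ge> 2" "i dvd x" "i\<^sup>2 \<le> x"
    by blast
  moreover from this have "i \<noteq> x"
    by (auto simp: power2_eq_square)
  ultimately show "\<not> prime x"
    by (auto simp: prime_nat_iff)
qed

definition multiples_ge_square :: "nat \<Rightarrow> nat \<Rightarrow> nat set" where
  "multiples_ge_square n i = {x \<in> {i\<^sup>2..n}. i dvd x}"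

lemma finite_multiples_ge_square [simp]: "finite (multiples_ge_square n i)"
  by (simp add: multiples_ge_square_def)

lemma UN_multiples_ge_square:
  "(\<Union>i\<in>{2..floor_sqrt n}. multiples_ge_square n i) = {x \<in> {2..n}. \<not> prime x}"
proof (intro set_eqI iffI)
  fix x assume "x \<in> (\<Union>i\<in>{2..floor_sqrt n}. multiples_ge_square n i)"
  then obtain i where i: "2 \<le> i" "i dvd x" "i\<^sup>2 \<le> x" "x \<le> n"
    by (auto simp: multiples_ge_square_def)
  then have "x > 1"
    using self_le_power[of i 2] by linarith
  with i show "x \<in> {x \<in> {2..n}. \<not> prime x}"
    using not_prime_iff_dvd_square_le by auto
next
  fix x assume x: "x \<in> {x \<in> {2..n}. \<not> prime x}"
  then obtain i where "2 \<le> i" "i dvd x" "i\<^sup>2 \<le> x"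
    using not_prime_iff_dvd_square_le[of x] by auto
  with x show "x \<in> (\<Union>i\<in>{2..floor_sqrt n}. multiples_ge_square n i)"
    by (auto simp: multiples_ge_square_def le_floor_sqrt_iff)
qed

lemma prime_pi_add_card_composites: "prime_pi n + card {x \<in> {2..n}. \<not> prime x} = n - 1"
proof -
  have "prime_pi n + card {x \<in> {2..n}. \<not> prime x} =
      card ({p. prime p \<and> p \<le> n} \<union> {x \<in> {2..n}. \<not> prime x})"
    unfolding prime_pi_def by (rule card_Un_disjoint[symmetric]) auto
  also have "{p. prime p \<and> p \<le> n} \<union> {x \<in> {2..n}. \<not> prime x} = {2..n}"
    by (auto simp: prime_ge_2_nat)
  finally show ?thesis
    by simp
qed

lemma card_multiples_greaterThanAtMost:
  fixes a b d :: nat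
  shows "card {x \<in> {a<..b}. d dvd x} = b div d - a div d"
proof (cases "d = 0")
  case False
  then have "d * k \<in> {a<..b} \<longleftrightarrow> k \<in> {a div d<..b div d}" for k
    by (simp add: div_less_iff_less_mult less_eq_div_iff_mult_less_eq mult.commute)
  then have "{x \<in> {a<..b}. d dvd x} = (*) d ` {a div d<..b div d}"
    unfolding dvd_def by blast
  with False show ?thesis
    by (simp add: card_image inj_on_mult)
qed auto

lemma INT_multiples_ge_square:
  assumes "finite I" "I \<noteq> {}"
  shows "(\<Inter>i\<in>I. multiples_ge_square n i) = {x \<in> {(Max I)\<^sup>2..n}. Lcm I dvd x}"
proof -
  have "(Max I)\<^sup>2 \<le> x \<longleftrightarrow> (\<forall>i\<in>I. i\<^sup>2 \<le> x)" for x
    using assms by (simp flip: le_floor_sqrt_iff)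
  with assms show ?thesis
    by (auto simp: multiples_ge_square_def Lcm_dvd_iff)
qed

lemma int_card_INT_multiples_ge_square:
  assumes "I \<subseteq> {2..floor_sqrt n}" "I \<noteq> {}"
  shows "int (card (\<Inter>i\<in>I. multiples_ge_square n i)) =
    \<lfloor>real n / real (Lcm I)\<rfloor> - \<lfloor>((real (Max I))\<^sup>2 - 1) / real (Lcm I)\<rfloor>"
proof -
  have "finite I"
    using assms(1) by (rule finite_subset) simp
  with assms have "Max I \<in> {2..floor_sqrt n}"
    using Max_in by blast
  then have "0 < (Max I)\<^sup>2" "(Max I)\<^sup>2 \<le> n"
    by (auto simp flip: le_floor_sqrt_iff)
  then have "{(Max I)\<^sup>2..n} = {(Max I)\<^sup>2 - 1<..n}"
    by (simp flip: atLeastSucAtMost_greaterThanAtMost)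
  then have "card (\<Inter>i\<in>I. multiples_ge_square n i) = n div Lcm I - ((Max I)\<^sup>2 - 1) div Lcm I"
    by (simp only: INT_multiples_ge_square[OF \<open>finite I\<close> assms(2)] card_multiples_greaterThanAtMost)
  moreover have "((Max I)\<^sup>2 - 1) div Lcm I \<le> n div Lcm I"
    using \<open>(Max I)\<^sup>2 \<le> n\<close> by (intro div_le_mono) simp
  moreover have "(real (Max I))\<^sup>2 - 1 = real ((Max I)\<^sup>2 - 1)"
    using \<open>0 < (Max I)\<^sup>2\<close> by (simp add: of_nat_diff)
  ultimately show ?thesis
    by (simp only: floor_divide_of_nat_eq of_nat_diff)
qed

lemma int_card_multiples_ge_square:
  assumes "i \<in> {2..floor_sqrt n}"
  shows "int (card (multiples_ge_square n i)) = \<lfloor>real n / real i\<rfloor> - int i + 1"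
proof -
  have "((real i)\<^sup>2 - 1) / real i = real i - 1 / real i"
    using assms by (simp add: field_simps power2_eq_square)
  moreover have "\<lfloor>real i - 1 / real i\<rfloor> = int i - 1"
    using assms by (intro floor_unique) auto
  ultimately show ?thesis
    using int_card_INT_multiples_ge_square[of "{i}" n] assms by simp
qed

lemma sum_card_INT_multiples_ge_square:
  assumes "s > 0"
  shows "(\<Sum>I | I \<subseteq> {2..floor_sqrt n} \<and> card I = s. int (card (\<Inter>i\<in>I. multiples_ge_square n i))) =
    (\<Sum>is \<in> increasing_tuples s (floor_sqrt n).
      \<lfloor>real n / real (Lcm (set is))\<rfloor> - \<lfloor>((real (last is))\<^sup>2 - 1) / real (Lcm (set is))\<rfloor>)"
proof -
  have "(\<Sum>I | I \<subseteq> {2..floor_sqrt n} \<and> card I = s. int (card (\<Inter>i\<in>I. multiples_ge_square n i))) =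
      (\<Sum>is \<in> increasing_tuples s (floor_sqrt n). int (card (\<Inter>i\<in>set is. multiples_ge_square n i)))"
    by (rule sum.reindex_bij_betw[OF bij_betw_set_increasing_tuples, symmetric])
  also have "\<dots> = (\<Sum>is \<in> increasing_tuples s (floor_sqrt n).
      \<lfloor>real n / real (Lcm (set is))\<rfloor> - \<lfloor>((real (last is))\<^sup>2 - 1) / real (Lcm (set is))\<rfloor>)"
  proof (rule sum.cong[OF refl])
    fix "is" assume "is \<in> increasing_tuples s (floor_sqrt n)"
    with assms have "set is \<subseteq> {2..floor_sqrt n}" "set is \<noteq> {}" "last is = Max (set is)"
      by (auto simp: increasing_tuples_def strict_sorted_iff intro!: sorted_last_eq_Max)
    then show "int (card (\<Inter>i\<in>set is. multiples_ge_square n i)) =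
        \<lfloor>real n / real (Lcm (set is))\<rfloor> - \<lfloor>((real (last is))\<^sup>2 - 1) / real (Lcm (set is))\<rfloor>"
      by (simp add: int_card_INT_multiples_ge_square)
  qed
  finally show ?thesis .
qed

theorem mainTheorem1:
  fixes n :: nat
  assumes "n \<ge> 1"
  shows "int (prime_pi n) =
      int n - 1
      - (\<Sum>i = 2..nat \<lfloor>sqrt (real n)\<rfloor>. \<lfloor>real n / real i\<rfloor> - int i + 1)
      + (\<Sum>s = 2..nat \<lfloor>sqrt (real n)\<rfloor>. (-1) ^ s *
          (\<Sum>is \<in> increasing_tuples s (nat \<lfloor>sqrt (real n)\<rfloor>).
             \<lfloor>real n / real (Lcm (set is))\<rfloor>
             - \<lfloor>((real (last is))\<^sup>2 - 1) / real (Lcm (set is))\<rfloor>))"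
proof -
  define m where "m = floor_sqrt n"
  have "int (prime_pi n) = int n - 1 - int (card (\<Union>i\<in>{2..m}. multiples_ge_square n i))"
    using assms prime_pi_add_card_composites[of n] by (simp add: m_def UN_multiples_ge_square)
  also have "\<dots> = int n - 1 - (\<Sum>i = 2..m. int (card (multiples_ge_square n i))) +
      (\<Sum>s = 2..m. (- 1) ^ s *
        (\<Sum>I | I \<subseteq> {2..m} \<and> card I = s. int (card (\<Inter>i\<in>I. multiples_ge_square n i))))"
    by (simp add: int_card_UN_by_card[where k = m])
  finally show ?thesis
    by (simp add: m_def nat_floor_sqrt_eq_floor_sqrt int_card_multiples_ge_square
        sum_card_INT_multiples_ge_square)
qed

end
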